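(* For $m\in\mathbb{N}$ let $K_m:=\{x\in\ell_\infty : x(k)\in\{0,1,\dots,m\}\text{ for all }k\in\mathbb{N}\}$ with the metric inherited from $\ell_\infty$ (and any designated origin). If $m\geq 3$, then the Banach space $\mathrm{Lip}_0(K_m)$ has the symmetric strong diameter two property (SSD2P).
   Context: All Banach spaces are real. $B_X$, $S_X$ denote the closed unit ball and unit sphere of a Banach space $X$. For a metric space $(M,d)$ with designated origin $0\in M$, $\mathrm{Lip}_0(M)$ is the Banach space of Lipschitz functions $f:M\to\mathbb{R}$ with $f(0)=0$, with norm $\|f\|=\sup_{x\neq y}\frac{|f(x)-f(y)|}{d(x,y)}$. (The choice of origin does not matter up to isometric isomorphism.) A slice of $B_X$ is a set $S(B_X,f,\alpha)=\{x\in B_X: f(x)>1-\alpha\}$ with $f\in S_{X^*}$, $\alpha>0$. $X$ has the SSD2P if for every $k\in\mathbb{N}$, all slices $S_1,\dots,S_k$ of $B_X$ and every $\varepsilon>0$, there are $x_i\in S_i$ and $\varphi\in B_X$ with $\|\varphi\|>1-\varepsilon$ such that $x_i\pm\varphi\in S_i$ for every $i\in\{1,\dots,k\}$. *)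

theory Defs
  imports "HOL-Analysis.Analysis" "HOL-Library.Function_Algebras"
begin

section \<open>Normed spaces with a carrier\<close>

text \<open>
  The space of Lipschitz functions on a metric space varies with that metric space, so it is
  not available as a type of class \<open>banach\<close>.  A normed space is therefore given by a carrier
  \<open>V\<close>, a linear subspace of a real vector space, together with a function \<open>N\<close> that is a
  norm on \<open>V\<close>.  Values of \<open>N\<close> and of functionals outside \<open>V\<close> play no role.
\<close>

definition normed_space_on :: "'v::real_vector set \<Rightarrow> ('v \<Rightarrow> real) \<Rightarrow> bool" where
  "normed_space_on V N \<longleftrightarrow> subspace V
     \<and> (\<forall>v\<in>V. 0 \<le> N v \<and> (N v = 0 \<longleftrightarrow> v = 0))
     \<and> (\<forall>v\<in>V. \<forall>c. N (c *\<^sub>R v) = \<bar>c\<bar> * N v)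
     \<and> (\<forall>v\<in>V. \<forall>w\<in>V. N (v + w) \<le> N v + N w)"

definition banach_space_on :: "'v::real_vector set \<Rightarrow> ('v \<Rightarrow> real) \<Rightarrow> bool" where
  "banach_space_on V N \<longleftrightarrow> normed_space_on V N
     \<and> (\<forall>X::nat \<Rightarrow> 'v. (\<forall>n. X n \<in> V)
          \<and> (\<forall>e>0. \<exists>n0. \<forall>m\<ge>n0. \<forall>n\<ge>n0. N (X m - X n) < e)
          \<longrightarrow> (\<exists>v\<in>V. (\<lambda>n. N (X n - v)) \<longlonglongrightarrow> 0))"

definition unit_ball_on :: "'v::real_vector set \<Rightarrow> ('v \<Rightarrow> real) \<Rightarrow> 'v set" where
  "unit_ball_on V N = {v \<in> V. N v \<le> 1}"

definition dual_on :: "'v::real_vector set \<Rightarrow> ('v \<Rightarrow> real) \<Rightarrow> ('v \<Rightarrow> real) set" where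
  "dual_on V N = {f. (\<forall>v\<in>V. \<forall>w\<in>V. f (v + w) = f v + f w)
                   \<and> (\<forall>v\<in>V. \<forall>c. f (c *\<^sub>R v) = c * f v)
                   \<and> (\<exists>C. \<forall>v\<in>V. \<bar>f v\<bar> \<le> C * N v)}"

definition dual_norm_on :: "'v::real_vector set \<Rightarrow> ('v \<Rightarrow> real) \<Rightarrow> ('v \<Rightarrow> real) \<Rightarrow> real" where
  "dual_norm_on V N f = (SUP v\<in>unit_ball_on V N. \<bar>f v\<bar>)"

definition dual_sphere_on :: "'v::real_vector set \<Rightarrow> ('v \<Rightarrow> real) \<Rightarrow> ('v \<Rightarrow> real) set" where
  "dual_sphere_on V N = {f \<in> dual_on V N. dual_norm_on V N f = 1}"

definition slice_on ::
  "'v::real_vector set \<Rightarrow> ('v \<Rightarrow> real) \<Rightarrow> ('v \<Rightarrow> real) \<Rightarrow> real \<Rightarrow> 'v set" where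
  "slice_on V N f \<alpha> = {v \<in> unit_ball_on V N. f v > 1 - \<alpha>}"

definition slices_on :: "'v::real_vector set \<Rightarrow> ('v \<Rightarrow> real) \<Rightarrow> 'v set set" where
  "slices_on V N = {slice_on V N f \<alpha> | f \<alpha>. f \<in> dual_sphere_on V N \<and> \<alpha> > 0}"

definition SSD2P :: "'v::real_vector set \<Rightarrow> ('v \<Rightarrow> real) \<Rightarrow> bool" where
  "SSD2P V N \<longleftrightarrow>
     (\<forall>k\<ge>1. \<forall>S::nat \<Rightarrow> 'v set. \<forall>\<epsilon>>0. (\<forall>i\<in>{1..k}. S i \<in> slices_on V N) \<longrightarrow>
        (\<exists>x \<phi>. (\<forall>i\<in>{1..k}. x i \<in> S i) \<and> \<phi> \<in> unit_ball_on V N \<and> N \<phi> > 1 - \<epsilon>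
             \<and> (\<forall>i\<in>{1..k}. x i + \<phi> \<in> S i \<and> x i - \<phi> \<in> S i)))"


section \<open>Spaces of Lipschitz functions\<close>

text \<open>Addition and subtraction of functions are pointwise already; so is scaling.\<close>

instantiation "fun" :: (type, real_vector) real_vector
begin

definition "scaleR c f = (\<lambda>x. c *\<^sub>R f x)"

instance
  by standard (auto simp: scaleR_fun_def fun_eq_iff scaleR_add_right scaleR_add_left)

end

lemma scaleR_fun_apply [simp]: "(c *\<^sub>R f) x = c *\<^sub>R f x"
  by (simp add: scaleR_fun_def)

text \<open>
  Functions on \<open>M\<close> are represented by functions on the whole type that vanish outside \<open>M\<close>;
  \<open>z\<close> is the designated origin.
\<close>

definition Lip0 :: "'a::metric_space set \<Rightarrow> 'a \<Rightarrow> ('a \<Rightarrow> real) set" where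
  "Lip0 M z = {f. (\<exists>L. L-lipschitz_on M f) \<and> f z = 0 \<and> (\<forall>x. x \<notin> M \<longrightarrow> f x = 0)}"

text \<open>
  The inserted \<open>0\<close> only matters when \<open>M\<close> has at most one point, where it makes the
  supremum over the empty set equal to \<open>0\<close>.
\<close>

definition lip_norm :: "'a::metric_space set \<Rightarrow> ('a \<Rightarrow> real) \<Rightarrow> real" where
  "lip_norm M f = Sup (insert 0 {\<bar>f x - f y\<bar> / dist x y | x y. x \<in> M \<and> y \<in> M \<and> x \<noteq> y})"

lemma lip_norm_leI:
  assumes "0 \<le> C" "\<And>x y. x \<in> M \<Longrightarrow> y \<in> M \<Longrightarrow> \<bar>f x - f y\<bar> \<le> C * dist x y"
  shows "lip_norm M f \<le> C"
  unfolding lip_norm_def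
  by (rule cSup_least) (use assms in \<open>auto simp: divide_le_eq\<close>)

lemma bdd_above_slopes:
  assumes "f \<in> Lip0 M z"
  shows "bdd_above (insert 0 {\<bar>f x - f y\<bar> / dist x y | x y. x \<in> M \<and> y \<in> M \<and> x \<noteq> y})"
proof -
  obtain L where L: "L-lipschitz_on M f"
    using assms by (auto simp: Lip0_def)
  show ?thesis
    by (rule bdd_aboveI[of _ L])
       (use lipschitz_on_nonneg[OF L] lipschitz_onD[OF L] in
         \<open>auto simp: divide_le_eq dist_real_def\<close>)
qed

lemma lip_norm_nonneg: "f \<in> Lip0 M z \<Longrightarrow> 0 \<le> lip_norm M f"
  unfolding lip_norm_def by (rule cSup_upper[OF _ bdd_above_slopes]) auto

lemma lip_norm_bound:
  assumes "f \<in> Lip0 M z" "x \<in> M" "y \<in> M"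
  shows "\<bar>f x - f y\<bar> \<le> lip_norm M f * dist x y"
proof (cases "x = y")
  case False
  then have "\<bar>f x - f y\<bar> / dist x y \<le> lip_norm M f"
    unfolding lip_norm_def using assms by (intro cSup_upper[OF _ bdd_above_slopes]) auto
  with False show ?thesis by (simp add: divide_le_eq)
qed auto

lemma Lip0I:
  assumes "0 \<le> C" "\<And>x y. x \<in> M \<Longrightarrow> y \<in> M \<Longrightarrow> \<bar>f x - f y\<bar> \<le> C * dist x y"
    and "f z = 0" "\<And>x. x \<notin> M \<Longrightarrow> f x = 0"
  shows "f \<in> Lip0 M z"
  unfolding Lip0_def using assms by (auto simp: lipschitz_on_def dist_real_def)

lemma Lip0_add_bound:
  assumes "f \<in> Lip0 M z" "g \<in> Lip0 M z" "x \<in> M" "y \<in> M"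
  shows "\<bar>(f + g) x - (f + g) y\<bar> \<le> (lip_norm M f + lip_norm M g) * dist x y"
  using lip_norm_bound[OF assms(1,3,4)] lip_norm_bound[OF assms(2,3,4)]
  by (simp add: distrib_right)

lemma Lip0_scale_bound:
  assumes "f \<in> Lip0 M z" "x \<in> M" "y \<in> M"
  shows "\<bar>(c *\<^sub>R f) x - (c *\<^sub>R f) y\<bar> \<le> (\<bar>c\<bar> * lip_norm M f) * dist x y"
  using mult_left_mono[OF lip_norm_bound[OF assms], of "\<bar>c\<bar>"]
  by (simp add: mult.assoc abs_mult flip: right_diff_distrib)

lemma subspace_Lip0: "subspace (Lip0 M z)"
  unfolding subspace_def
proof (intro conjI ballI allI)
  show "0 \<in> Lip0 M z" by (rule Lip0I[of 0]) auto
next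
  fix f g assume fg: "f \<in> Lip0 M z" "g \<in> Lip0 M z"
  show "f + g \<in> Lip0 M z"
    by (rule Lip0I[OF _ Lip0_add_bound[OF fg]])
       (use fg lip_norm_nonneg[OF fg(1)] lip_norm_nonneg[OF fg(2)] in \<open>auto simp: Lip0_def\<close>)
next
  fix f c assume f: "f \<in> Lip0 M z"
  show "c *\<^sub>R f \<in> Lip0 M z"
    by (rule Lip0I[OF _ Lip0_scale_bound[OF f]])
       (use f lip_norm_nonneg[OF f] in \<open>auto simp: Lip0_def\<close>)
qed

lemma normed_space_Lip0:
  assumes z: "z \<in> M"
  shows "normed_space_on (Lip0 M z) (lip_norm M)"
proof -
  have zero: "lip_norm M f = 0 \<longleftrightarrow> f = 0" if f: "f \<in> Lip0 M z" for f
  proof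
    assume "lip_norm M f = 0"
    then have "f x = 0" for x
      using lip_norm_bound[OF f _ z, of x] f by (cases "x \<in> M") (auto simp: Lip0_def)
    then show "f = 0" by auto
  next
    assume "f = 0"
    then have "lip_norm M f \<le> 0" by (intro lip_norm_leI) auto
    with lip_norm_nonneg[OF f] show "lip_norm M f = 0" by simp
  qed
  have scale_le: "lip_norm M (c *\<^sub>R f) \<le> \<bar>c\<bar> * lip_norm M f" if "f \<in> Lip0 M z" for c f
    by (rule lip_norm_leI[OF _ Lip0_scale_bound[OF that]]) (simp_all add: lip_norm_nonneg[OF that])
  have scale: "lip_norm M (c *\<^sub>R f) = \<bar>c\<bar> * lip_norm M f" if f: "f \<in> Lip0 M z" for c f
  proof (cases "c = 0")
    case True
    then show ?thesis using zero[OF subspace_0[OF subspace_Lip0]] by simp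
  next
    case False
    have "lip_norm M f \<le> \<bar>inverse c\<bar> * lip_norm M (c *\<^sub>R f)"
      using scale_le[of "c *\<^sub>R f" "inverse c"] subspace_scale[OF subspace_Lip0 f] False by simp
    with False have "\<bar>c\<bar> * lip_norm M f \<le> lip_norm M (c *\<^sub>R f)"
      by (simp add: field_simps)
    with scale_le[OF f, of c] show ?thesis by simp
  qed
  have "lip_norm M (f + g) \<le> lip_norm M f + lip_norm M g"
    if "f \<in> Lip0 M z" "g \<in> Lip0 M z" for f g
    by (rule lip_norm_leI[OF _ Lip0_add_bound[OF that]])
       (simp_all add: lip_norm_nonneg[OF that(1)] lip_norm_nonneg[OF that(2)])
  with zero scale show ?thesis
    unfolding normed_space_on_def by (auto simp: subspace_Lip0 lip_norm_nonneg)
qed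

theorem banach_space_Lip0:
  fixes M :: "'a::metric_space set"
  assumes z: "z \<in> M"
  shows "banach_space_on (Lip0 M z) (lip_norm M)"
  unfolding banach_space_on_def
proof (intro conjI normed_space_Lip0[OF z] allI impI, elim conjE)
  fix X :: "nat \<Rightarrow> 'a \<Rightarrow> real"
  assume X: "\<forall>n. X n \<in> Lip0 M z"
    and cau: "\<forall>e>0. \<exists>n0. \<forall>m\<ge>n0. \<forall>n\<ge>n0. lip_norm M (X m - X n) < e"
  have diff: "X m - X n \<in> Lip0 M z" for m n
    using X subspace_diff[OF subspace_Lip0] by blast
  have "convergent (\<lambda>n. X n x)" for x
  proof (cases "x \<in> M")
    case True
    have "Cauchy (\<lambda>n. X n x)"
    proof (rule metric_CauchyI)
      fix e :: real assume e: "e > 0"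
      then have "e / (dist x z + 1) > 0" by (simp add: add_nonneg_pos)
      then obtain n0 where n0: "\<And>m n. m \<ge> n0 \<Longrightarrow> n \<ge> n0 \<Longrightarrow> lip_norm M (X m - X n) < e / (dist x z + 1)"
        using cau by blast
      have "dist (X m x) (X n x) < e" if "m \<ge> n0" "n \<ge> n0" for m n
      proof -
        have "X m z = 0" "X n z = 0" using X by (auto simp: Lip0_def)
        then have "\<bar>X m x - X n x\<bar> \<le> lip_norm M (X m - X n) * dist x z"
          using lip_norm_bound[OF diff True z, of m n] by simp
        also have "\<dots> \<le> e / (dist x z + 1) * dist x z"
          using n0[OF that] by (intro mult_right_mono) auto
        also have "\<dots> < e"
          using e by (simp add: divide_less_eq add_nonneg_pos distrib_left)
        finally show ?thesis by (simp add: dist_real_def)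
      qed
      then show "\<exists>n0. \<forall>m\<ge>n0. \<forall>n\<ge>n0. dist (X m x) (X n x) < e" by blast
    qed
    then show ?thesis by (simp add: Cauchy_convergent_iff)
  next
    case False
    then have "(\<lambda>n. X n x) = (\<lambda>n. 0)" using X by (auto simp: Lip0_def)
    then show ?thesis by (simp add: convergent_const)
  qed
  then obtain g where g: "\<And>x. (\<lambda>n. X n x) \<longlonglongrightarrow> g x"
    unfolding convergent_def by metis
  have g_z: "g z = 0"
    using g[of z] X by (auto simp: Lip0_def LIMSEQ_const_iff)
  have g_out: "g x = 0" if "x \<notin> M" for x
    using g[of x] X that by (auto simp: Lip0_def LIMSEQ_const_iff)
  have close: "\<exists>n0. \<forall>n\<ge>n0. \<forall>x\<in>M. \<forall>y\<in>M. \<bar>(X n - g) x - (X n - g) y\<bar> \<le> e * dist x y"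
    if "e > 0" for e
  proof -
    obtain n0 where n0: "\<And>m n. m \<ge> n0 \<Longrightarrow> n \<ge> n0 \<Longrightarrow> lip_norm M (X m - X n) < e"
      using cau[rule_format, OF \<open>e > 0\<close>] by blast
    have "\<bar>(X n - g) x - (X n - g) y\<bar> \<le> e * dist x y" if n: "n \<ge> n0" and xy: "x \<in> M" "y \<in> M" for n x y
    proof -
      have "(\<lambda>m. \<bar>(X n x - X m x) - (X n y - X m y)\<bar>) \<longlonglongrightarrow> \<bar>(X n x - g x) - (X n y - g y)\<bar>"
        by (intro tendsto_intros g)
      moreover have "\<bar>(X n x - X m x) - (X n y - X m y)\<bar> \<le> e * dist x y" if "m \<ge> n0" for m
      proof -
        have "\<bar>(X n - X m) x - (X n - X m) y\<bar> \<le> lip_norm M (X n - X m) * dist x y"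
          by (rule lip_norm_bound[OF diff xy])
        also have "\<dots> \<le> e * dist x y"
          using n0[OF n that] by (intro mult_right_mono) auto
        finally show ?thesis by simp
      qed
      ultimately have "\<bar>(X n x - g x) - (X n y - g y)\<bar> \<le> e * dist x y"
        by (intro LIMSEQ_le_const2) blast+
      then show ?thesis by simp
    qed
    then show ?thesis by blast
  qed
  obtain n1 where n1: "\<forall>x\<in>M. \<forall>y\<in>M. \<bar>(X n1 - g) x - (X n1 - g) y\<bar> \<le> 1 * dist x y"
    using close[of 1] by auto
  have "X n1 - g \<in> Lip0 M z"
    by (rule Lip0I[of 1]) (use n1 X g_z g_out in \<open>auto simp: Lip0_def\<close>)
  then have "X n1 - (X n1 - g) \<in> Lip0 M z"
    using X subspace_diff[OF subspace_Lip0] by blast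
  moreover have "X n1 - (X n1 - g) = g" by (rule ext) simp
  ultimately have gL: "g \<in> Lip0 M z" by metis
  have "(\<lambda>n. lip_norm M (X n - g)) \<longlonglongrightarrow> 0"
  proof (rule metric_LIMSEQ_I)
    fix e :: real assume e: "e > 0"
    then obtain n0 where n0: "\<And>n x y. n \<ge> n0 \<Longrightarrow> x \<in> M \<Longrightarrow> y \<in> M
        \<Longrightarrow> \<bar>(X n - g) x - (X n - g) y\<bar> \<le> e / 2 * dist x y"
      using close[of "e / 2"] by (metis half_gt_zero)
    have "dist (lip_norm M (X n - g)) 0 < e" if "n \<ge> n0" for n
    proof -
      have "lip_norm M (X n - g) \<le> e / 2"
        using e n0[OF that] by (intro lip_norm_leI) auto
      moreover have "X n - g \<in> Lip0 M z"
        using X gL subspace_diff[OF subspace_Lip0] by blast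
      ultimately show ?thesis
        using e lip_norm_nonneg[of "X n - g" M z] by (simp add: dist_real_def)
    qed
    then show "\<exists>n0. \<forall>n\<ge>n0. dist (lip_norm M (X n - g)) 0 < e" by blast
  qed
  with gL show "\<exists>v\<in>Lip0 M z. (\<lambda>n. lip_norm M (X n - v)) \<longlonglongrightarrow> 0" by blast
qed


section \<open>The metric spaces of integer-valued sequences\<close>

text \<open>
  The type \<^typ>\<open>nat \<Rightarrow>\<^sub>C real\<close> is the space of bounded real sequences with the supremum
  metric, since every function on the discrete space \<^typ>\<open>nat\<close> is continuous.
\<close>

type_synonym ell_infty = "nat \<Rightarrow>\<^sub>C real"

definition K :: "nat \<Rightarrow> ell_infty set" where
  "K m = {x. \<forall>k. apply_bcontfun x k \<in> real ` {0..m}}"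

end

theory Submission
  imports Defs
begin

text \<open>
  Distinct points of \<open>K m\<close> are at distance at least \<open>1\<close>, so every bounded function that vanishes
  at the origin is Lipschitz, with a norm controlled by the supremum norm.  Consequently a
  uniformly bounded sequence of functions with disjoint supports is weakly null: a functional
  that stayed away from \<open>0\<close> on it would be unbounded on signed finite sums of its terms
  (\<open>disjoint_supports_weakly_null\<close>).

  Given members \<open>x\<^sub>1, \<dots>, x\<^sub>k\<close> of the slices, it is therefore enough to change all of them
  inside small sets \<open>B\<^sub>n\<close>, pairwise disjoint, so that inside \<open>B\<^sub>n\<close> there is room for one common
  perturbation of norm \<open>1\<close>; for large \<open>n\<close> no slice notices the change.  The perturbation is a
  dipole, with value \<open>1/2\<close> at a point \<open>u\<close> and \<open>-1/2\<close> at a point \<open>v\<close> at distance \<open>1\<close> from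
  \<open>u\<close>.  Let \<open>D w\<close> be the distance of \<open>w\<close> to the pair \<open>{u, v}\<close>.  A 1-Lipschitz function \<open>y\<close>
  with the same value \<open>c\<close> at \<open>u\<close> and at \<open>v\<close> stays 1-Lipschitz after adding or subtracting
  the dipole as soon as \<open>\<bar>y w - c\<bar> \<le> D w - 1/2\<close> for all other \<open>w\<close>.  Clamping \<open>x\<close> to this band
  yields such a \<open>y\<close>.  Nothing changes where \<open>D w \<ge> 2\<close>, for a suitable \<open>c\<close>, provided that any
  two points \<open>w\<close>, \<open>w'\<close> of this region satisfy \<open>dist w w' \<le> D w + D w' - 1\<close>: this is
  what makes the intervals of admissible \<open>c\<close> meet (\<open>flatten_at_pair\<close>).

  In \<open>K m\<close> let \<open>u\<^sub>n\<close> be the sequence with entry \<open>m\<close> at place \<open>n + 1\<close> and \<open>0\<close> elsewhere, and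
  let \<open>v\<^sub>n\<close> be \<open>u\<^sub>n\<close> with entry \<open>1\<close> at place \<open>0\<close>.  The inequality above holds since the entries
  of \<open>u\<^sub>n\<close> are extreme: seen from the end \<open>0\<close> or \<open>m\<close> of \<open>{0..m}\<close>, the farther one of two
  entries is at least as far away as they are from each other, and the \<open>2\<close> contributed by the
  nearer one makes up for the \<open>-1\<close> and for the entry \<open>1\<close> of \<open>v\<^sub>n\<close> (\<open>dist_via_spikes\<close>).  The sets
  \<open>B\<^sub>n = {w. D w < 2}\<close> are disjoint since a point of \<open>B\<^sub>n\<close> has an entry at least
  \<open>m - 1 \<ge> 2\<close> at place \<open>n + 1\<close>, and a point of any other \<open>B\<^sub>n\<^sub>'\<close> has an entry at most \<open>1\<close>
  there; this is where \<open>m \<ge> 3\<close> enters.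
\<close>

section \<open>Uniformly discrete metric spaces\<close>

lemma bounded_in_Lip0:
  fixes f :: "'a::metric_space \<Rightarrow> real"
  assumes discrete: "\<And>x y. x \<in> M \<Longrightarrow> y \<in> M \<Longrightarrow> x \<noteq> y \<Longrightarrow> 1 \<le> dist x y"
    and bound: "\<And>x. \<bar>f x\<bar> \<le> C"
    and "f z = 0" "\<And>x. x \<notin> M \<Longrightarrow> f x = 0"
  shows "f \<in> Lip0 M z" and "lip_norm M f \<le> 2 * C"
proof -
  have C: "0 \<le> C" using bound[of z] by linarith
  have slope: "\<bar>f x - f y\<bar> \<le> (2 * C) * dist x y" if "x \<in> M" "y \<in> M" for x y
  proof (cases "x = y")
    case False
    have "\<bar>f x - f y\<bar> \<le> 2 * C" using bound[of x] bound[of y] by linarith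
    also have "\<dots> \<le> (2 * C) * dist x y"
      using mult_left_mono[OF discrete[OF that False], of "2 * C"] C by simp
    finally show ?thesis .
  qed simp
  show "f \<in> Lip0 M z" by (rule Lip0I[OF _ slope]) (use C assms(3,4) in auto)
  show "lip_norm M f \<le> 2 * C" by (rule lip_norm_leI[OF _ slope]) (use C in auto)
qed

lemma dual_on_sum:
  assumes V: "subspace V" and g: "g \<in> dual_on V N"
    and "finite F" "\<And>n. n \<in> F \<Longrightarrow> h n \<in> V"
  shows "g (\<Sum>n\<in>F. c n *\<^sub>R h n) = (\<Sum>n\<in>F. c n * g (h n))"
  using assms(3,4)
proof (induction F rule: finite_induct)
  case empty
  have "g (0 *\<^sub>R 0) = 0 * g 0"
    using g subspace_0[OF V] unfolding dual_on_def by blast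
  then show ?case by simp
next
  case (insert a F)
  have "(\<Sum>n\<in>F. c n *\<^sub>R h n) \<in> V"
    by (intro subspace_sum[OF V] subspace_scale[OF V]) (use insert in auto)
  moreover have "c a *\<^sub>R h a \<in> V" "h a \<in> V"
    using insert by (auto intro: subspace_scale[OF V])
  ultimately have "g (c a *\<^sub>R h a + (\<Sum>n\<in>F. c n *\<^sub>R h n)) = c a * g (h a) + g (\<Sum>n\<in>F. c n *\<^sub>R h n)"
    using g unfolding dual_on_def by simp
  with insert show ?case by simp
qed

text \<open>
  With disjoint supports, signed sums of the functions obey the same pointwise bound \<open>C\<close> as the
  functions, so their norms are at most \<open>2 * C\<close> however many terms there are.  If infinitely
  many values \<open>g (h n)\<close> were at least \<open>\<delta>\<close> in modulus, \<open>g\<close> would be unbounded on such sums.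
\<close>
lemma disjoint_supports_weakly_null:
  fixes h :: "'i \<Rightarrow> 'a::metric_space \<Rightarrow> real"
  assumes discrete: "\<And>x y. x \<in> M \<Longrightarrow> y \<in> M \<Longrightarrow> x \<noteq> y \<Longrightarrow> 1 \<le> dist x y"
    and g: "g \<in> dual_on (Lip0 M z) (lip_norm M)"
    and h: "\<And>n. n \<in> J \<Longrightarrow> h n \<in> Lip0 M z"
    and bound: "\<And>n x. n \<in> J \<Longrightarrow> \<bar>h n x\<bar> \<le> C"
    and disjoint: "\<And>n n' x. n \<in> J \<Longrightarrow> n' \<in> J \<Longrightarrow> n \<noteq> n' \<Longrightarrow> h n x = 0 \<or> h n' x = 0"
    and "0 < \<delta>"
  shows "finite {n \<in> J. \<delta> \<le> \<bar>g (h n)\<bar>}"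
proof (rule ccontr)
  assume infinite: "\<not> ?thesis"
  obtain n where "n \<in> J"
    using infinite by (metis (no_types, lifting) empty_Collect_eq finite.emptyI)
  then have C: "0 \<le> C" using bound[of n undefined] by linarith
  obtain B where B: "\<And>f. f \<in> Lip0 M z \<Longrightarrow> \<bar>g f\<bar> \<le> B * lip_norm M f"
    using g unfolding dual_on_def by blast
  obtain k :: nat where k: "\<bar>B\<bar> * (2 * C) < real k * \<delta>"
    using \<open>0 < \<delta>\<close> reals_Archimedean3 by blast
  obtain F where F: "F \<subseteq> {n \<in> J. \<delta> \<le> \<bar>g (h n)\<bar>}" "finite F" "card F = k"
    using infinite_arbitrarily_large[OF infinite] by blast
  \<comment> \<open>The signs make all terms add up under \<open>g\<close>.\<close>
  define s where "s = (\<Sum>n\<in>F. sgn (g (h n)) *\<^sub>R h n)"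
  have s_apply: "s x = (\<Sum>n\<in>F. sgn (g (h n)) * h n x)" for x
    unfolding s_def using F(2) by (induction F rule: finite_induct) auto
  have "\<bar>s x\<bar> \<le> C" for x
  proof (cases "\<exists>n\<in>F. h n x \<noteq> 0")
    case True
    then obtain a where a: "a \<in> F" "h a x \<noteq> 0" by blast
    have others: "h n x = 0" if "n \<in> F - {a}" for n
      using disjoint[of a n x] a that F(1) by blast
    have "s x = sgn (g (h a)) * h a x"
      unfolding s_apply by (subst sum.remove[OF F(2) a(1)]) (simp add: others)
    then have "\<bar>s x\<bar> \<le> \<bar>h a x\<bar>" by (auto simp: abs_mult sgn_if)
    also have "\<dots> \<le> C" using bound a(1) F(1) by blast
    finally show ?thesis .
  next
    case False
    then show ?thesis using C by (simp add: s_apply)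
  qed
  moreover have "s z = 0" "\<And>x. x \<notin> M \<Longrightarrow> s x = 0"
    unfolding s_apply using h F(1) by (fastforce simp: Lip0_def intro!: sum.neutral)+
  ultimately have s: "s \<in> Lip0 M z" "lip_norm M s \<le> 2 * C"
    using bounded_in_Lip0[OF discrete] by blast+
  have "real k * \<delta> \<le> (\<Sum>n\<in>F. \<bar>g (h n)\<bar>)"
    using sum_bounded_below[of F \<delta> "\<lambda>n. \<bar>g (h n)\<bar>"] F by auto
  also have "\<dots> = g s"
  proof -
    have "g s = (\<Sum>n\<in>F. sgn (g (h n)) * g (h n))"
      unfolding s_def by (rule dual_on_sum[OF subspace_Lip0 g F(2)]) (use F h in auto)
    then show ?thesis by (simp add: abs_sgn mult.commute)
  qed
  also have "\<dots> \<le> \<bar>B\<bar> * lip_norm M s"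
    using B[OF s(1)] mult_right_mono[OF abs_ge_self[of B] lip_norm_nonneg[OF s(1)]] by linarith
  also have "\<dots> \<le> \<bar>B\<bar> * (2 * C)"
    using s(2) by (intro mult_left_mono) auto
  finally show False using k by linarith
qed

section \<open>Flattening Lipschitz functions at a pair of points\<close>

definition pair_dist :: "'a::metric_space \<Rightarrow> 'a \<Rightarrow> 'a \<Rightarrow> real" where
  "pair_dist u v w = min (dist u w) (dist v w)"

definition dipole :: "'a \<Rightarrow> 'a \<Rightarrow> 'a \<Rightarrow> real" where
  "dipole u v w = (if w = u then 1/2 else if w = v then -1/2 else 0)"

lemma pair_dist_triangle: "\<bar>pair_dist u v w - pair_dist u v w'\<bar> \<le> dist w w'"
  unfolding pair_dist_def
  using dist_triangle[of u w w'] dist_triangle[of u w' w]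
    dist_triangle[of v w w'] dist_triangle[of v w' w]
  by (auto simp: min_def dist_commute abs_le_iff)

lemma dipole_lip_norm:
  fixes u v z :: "'a::metric_space"
  assumes discrete: "\<And>x y. x \<in> M \<Longrightarrow> y \<in> M \<Longrightarrow> x \<noteq> y \<Longrightarrow> 1 \<le> dist x y"
    and uv: "u \<in> M" "v \<in> M" "dist u v = 1" and z: "z \<noteq> u" "z \<noteq> v"
  shows "dipole u v \<in> Lip0 M z" and "lip_norm M (dipole u v) = 1"
proof -
  have "\<bar>dipole u v x\<bar> \<le> 1/2" for x by (simp add: dipole_def)
  moreover have "dipole u v z = 0" "\<And>x. x \<notin> M \<Longrightarrow> dipole u v x = 0"
    using uv z by (auto simp: dipole_def)
  ultimately have *: "dipole u v \<in> Lip0 M z" "lip_norm M (dipole u v) \<le> 2 * (1/2)"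
    using bounded_in_Lip0[OF discrete] by blast+
  then show "dipole u v \<in> Lip0 M z" by simp
  have "u \<noteq> v" using uv by auto
  then show "lip_norm M (dipole u v) = 1"
    using *(2) lip_norm_bound[OF *(1) uv(1,2)] uv(3) by (simp add: dipole_def)
qed

text \<open>
  The cutoff \<open>2\<close> separates the points where \<open>x\<close> may be changed from those where it must not be.
  As \<open>x\<close> is 1-Lipschitz, inequality \<open>far\<close> makes the intervals of the values \<open>c\<close> that tolerate
  \<open>x w\<close>, with centre \<open>x w\<close> and radius \<open>pair_dist u v w - 1/2\<close>, meet pairwise, hence they have a
  common point.  Nearer to the pair, \<open>x\<close> is clamped to the band that this \<open>c\<close> prescribes.
\<close>
lemma flatten_at_pair:
  fixes u v z :: "'a::metric_space"
  assumes discrete: "\<And>x y. x \<in> M \<Longrightarrow> y \<in> M \<Longrightarrow> x \<noteq> y \<Longrightarrow> 1 \<le> dist x y"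
    and diam: "\<And>x y. x \<in> M \<Longrightarrow> y \<in> M \<Longrightarrow> dist x y \<le> R"
    and uv: "u \<in> M" "v \<in> M" "dist u v = 1"
    and z: "z \<in> M" "2 \<le> pair_dist u v z"
    and far: "\<And>w w'. w \<in> M \<Longrightarrow> w' \<in> M \<Longrightarrow> 2 \<le> pair_dist u v w \<Longrightarrow> 2 \<le> pair_dist u v w'
      \<Longrightarrow> dist w w' \<le> pair_dist u v w + pair_dist u v w' - 1"
    and x: "x \<in> Lip0 M z" "lip_norm M x \<le> 1"
  obtains y where "y \<in> Lip0 M z" "lip_norm M (y + dipole u v) \<le> 1" "lip_norm M (y - dipole u v) \<le> 1"
    "\<And>w. 2 \<le> pair_dist u v w \<Longrightarrow> y w = x w" "\<And>w. \<bar>y w - x w\<bar> \<le> 2 * R"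
proof -
  let ?D = "pair_dist u v"
  have x_lip: "\<bar>x w - x w'\<bar> \<le> dist w w'" if "w \<in> M" "w' \<in> M" for w w'
  proof -
    have "\<bar>x w - x w'\<bar> \<le> lip_norm M x * dist w w'" by (rule lip_norm_bound[OF x(1) that])
    also have "\<dots> \<le> 1 * dist w w'" using x(2) by (intro mult_right_mono) auto
    finally show ?thesis by simp
  qed
  have xz: "x z = 0" and x_out: "\<And>w. w \<notin> M \<Longrightarrow> x w = 0" using x(1) by (auto simp: Lip0_def)
  have R: "0 \<le> R" using diam[OF z(1) z(1)] by simp
  define L where "L = {w \<in> M. 2 \<le> ?D w}"
  have zL: "z \<in> L" using z by (simp add: L_def)
  define c where "c = (SUP w\<in>L. x w - (?D w - 1/2))"
  have gap: "x w - (?D w - 1/2) \<le> x w' + (?D w' - 1/2)" if "w \<in> L" "w' \<in> L" for w w'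
    using that far[of w w'] x_lip[of w w'] by (auto simp: L_def)
  have c_lower: "x w - (?D w - 1/2) \<le> c" if "w \<in> L" for w
    unfolding c_def by (rule cSUP_upper[OF that bdd_aboveI2], rule gap[OF _ zL])
  have c_upper: "c \<le> x w + (?D w - 1/2)" if "w \<in> L" for w
    unfolding c_def using that zL gap[OF _ that] by (intro cSUP_least) auto
  have Dz: "?D z \<le> R" using diam[OF uv(1) z(1)] by (simp add: pair_dist_def)
  have c_bound: "\<bar>c\<bar> \<le> R" using c_lower[OF zL] c_upper[OF zL] Dz xz by simp
  \<comment> \<open>At \<open>u\<close> and \<open>v\<close> the band would have the negative radius \<open>-1/2\<close>, hence the separate case.\<close>
  define y where "y = (\<lambda>w. if w \<notin> M then 0 else if w = u \<or> w = v then c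
    else max (c - (?D w - 1/2)) (min (c + (?D w - 1/2)) (x w)))"
  have D1: "1 \<le> ?D w" if "w \<in> M" "w \<noteq> u" "w \<noteq> v" for w
    using discrete[OF uv(1) that(1)] discrete[OF uv(2) that(1)] that by (simp add: pair_dist_def)
  have D0: "?D u = 0" "?D v = 0" by (simp_all add: pair_dist_def)
  have y_far: "y w = x w" if "2 \<le> ?D w" for w
  proof (cases "w \<in> M")
    case True
    moreover have "w \<noteq> u" "w \<noteq> v" using that D0 by auto
    ultimately show ?thesis
      using c_lower[of w] c_upper[of w] that by (auto simp: y_def L_def)
  qed (simp add: y_def x_out)
  have y_band: "\<bar>y w - c\<bar> \<le> ?D w - 1/2" if "w \<in> M" "w \<noteq> u" "w \<noteq> v" for w
    using that D1[OF that] by (auto simp: y_def)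
  have y_close: "\<bar>y w - x w\<bar> \<le> 2 * R" for w
  proof (cases "w \<in> M")
    case True
    have "\<bar>y w - x w\<bar> \<le> \<bar>c - x w\<bar>"
      using True D1[OF True] by (auto simp: y_def)
    moreover have "\<bar>x w\<bar> \<le> R" using x_lip[OF True z(1)] diam[OF True z(1)] xz by simp
    ultimately show ?thesis using c_bound by linarith
  qed (simp add: y_def x_out R)
  have y_lip: "\<bar>y w - y w'\<bar> \<le> dist w w'"
    if "w \<in> M" "w \<noteq> u" "w \<noteq> v" "w' \<in> M" "w' \<noteq> u" "w' \<noteq> v" for w w'
    using that x_lip[OF that(1,4)] pair_dist_triangle[of u v w w'] by (auto simp: y_def)
  have yu: "y u = c" "y v = c" using uv by (auto simp: y_def)
  have key: "\<bar>(y w + t * dipole u v w) - (y w' + t * dipole u v w')\<bar> \<le> dist w w'"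
    if w: "w \<in> M" "w' \<in> M" and t: "\<bar>t\<bar> = 1" for t w w'
  proof -
    let ?e = "\<lambda>w. y w + t * dipole u v w"
    have t': "t = 1 \<or> t = -1" using t by linarith
    have pair: "?e p = c + 1/2 \<or> ?e p = c - 1/2" if "p = u \<or> p = v" for p
      using that t' yu by (auto simp: dipole_def)
    have off: "?e q = y q" if "q \<noteq> u" "q \<noteq> v" for q
      using that by (simp add: dipole_def)
    have mixed: "\<bar>?e p - ?e q\<bar> \<le> dist p q" if p: "p = u \<or> p = v" and q: "q \<in> M" "q \<noteq> u" "q \<noteq> v" for p q
    proof -
      have "?D q \<le> dist p q" using p by (auto simp: pair_dist_def)
      then show ?thesis using pair[OF p] off[OF q(2,3)] y_band[OF q] by auto
    qed
    consider "w = w'" | "w \<noteq> w'" "w = u \<or> w = v" "w' = u \<or> w' = v"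
      | "w = u \<or> w = v" "w' \<noteq> u" "w' \<noteq> v" | "w' = u \<or> w' = v" "w \<noteq> u" "w \<noteq> v"
      | "w \<noteq> u" "w \<noteq> v" "w' \<noteq> u" "w' \<noteq> v" by blast
    then show ?thesis
    proof cases
      case 2
      then have "dist w w' = 1" using uv(3) by (auto simp: dist_commute)
      then show ?thesis using pair[OF 2(2)] pair[OF 2(3)] by auto
    next
      case 3
      then show ?thesis using mixed w by blast
    next
      case 4
      then show ?thesis using mixed[OF 4(1) w(1) 4(2,3)] by (simp add: dist_commute abs_minus_commute)
    next
      case 5
      show ?thesis
        unfolding off[OF 5(1,2)] off[OF 5(3,4)] by (rule y_lip[OF w(1) 5(1,2) w(2) 5(3,4)])
    qed auto
  qed
  have y: "y \<in> Lip0 M z"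
  proof (rule Lip0I[of 1])
    show "\<bar>y w - y w'\<bar> \<le> 1 * dist w w'" if "w \<in> M" "w' \<in> M" for w w'
      using key[OF that, of 1] key[OF that, of "-1"] by auto
  qed (use y_far[OF z(2)] xz in \<open>auto simp: y_def\<close>)
  show ?thesis
  proof (rule that[OF y _ _ y_far y_close])
    show "lip_norm M (y + dipole u v) \<le> 1"
      by (rule lip_norm_leI) (use key[where t = 1] in auto)
    show "lip_norm M (y - dipole u v) \<le> 1"
      by (rule lip_norm_leI) (use key[where t = "-1"] in auto)
  qed auto
qed

section \<open>A metric criterion for the symmetric strong diameter two property\<close>

lemma slice_on_nonempty:
  assumes V: "normed_space_on V N" and f: "f \<in> dual_sphere_on V N" and "0 < \<alpha>"
  obtains x where "x \<in> slice_on V N f \<alpha>"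
proof -
  have subspace: "subspace V" using V by (simp add: normed_space_on_def)
  have zeroV: "0 \<in> V" by (rule subspace_0[OF subspace])
  moreover have "N 0 = 0" using V zeroV by (simp only: normed_space_on_def)
  ultimately have zero: "0 \<in> unit_ball_on V N" by (simp add: unit_ball_on_def)
  have sup: "1 - \<alpha> < (SUP v\<in>unit_ball_on V N. \<bar>f v\<bar>)"
    using f \<open>0 < \<alpha>\<close> by (simp add: dual_sphere_on_def dual_norm_on_def)
  have nonempty: "(\<lambda>v. \<bar>f v\<bar>) ` unit_ball_on V N \<noteq> {}" using zero by blast
  obtain a where "a \<in> (\<lambda>v. \<bar>f v\<bar>) ` unit_ball_on V N" "1 - \<alpha> < a"
    by (rule less_cSupE[OF sup nonempty])
  then obtain v where v: "v \<in> unit_ball_on V N" "1 - \<alpha> < \<bar>f v\<bar>" by blast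
  have vV: "v \<in> V" "N v \<le> 1" using v(1) by (simp_all add: unit_ball_on_def)
  have "(-1) *\<^sub>R v \<in> V" by (rule subspace_scale[OF subspace vV(1)])
  moreover have "N ((-1) *\<^sub>R v) = \<bar>-1\<bar> * N v"
    using V vV(1) by (simp only: normed_space_on_def)
  moreover have "f ((-1) *\<^sub>R v) = (-1) * f v"
    using f vV(1) by (simp only: dual_sphere_on_def dual_on_def mem_Collect_eq)
  ultimately have minus: "(-1) *\<^sub>R v \<in> unit_ball_on V N" "f ((-1) *\<^sub>R v) = - f v"
    using vV(2) by (simp_all only: unit_ball_on_def mem_Collect_eq) auto
  show ?thesis
  proof (cases "0 \<le> f v")
    case True
    with v show ?thesis by (intro that[of v]) (simp add: slice_on_def)
  next
    case False
    with v minus show ?thesis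
      by (intro that[of "(-1) *\<^sub>R v"]) (simp add: slice_on_def del: scaleR_minus_left)
  qed
qed

text \<open>
  Infinitely many pairs are needed because it cannot be predicted where the given functionals
  are concentrated: each of them rules out finitely many pairs only.
\<close>
theorem SSD2P_criterion:
  fixes u v :: "nat \<Rightarrow> 'a::metric_space"
  assumes discrete: "\<And>x y. x \<in> M \<Longrightarrow> y \<in> M \<Longrightarrow> x \<noteq> y \<Longrightarrow> 1 \<le> dist x y"
    and diam: "\<And>x y. x \<in> M \<Longrightarrow> y \<in> M \<Longrightarrow> dist x y \<le> R"
    and z: "z \<in> M"
    and uv: "\<And>n. u n \<in> M" "\<And>n. v n \<in> M" "\<And>n. dist (u n) (v n) = 1"
    and disjoint: "\<And>n n' w. w \<in> M \<Longrightarrow> n \<noteq> n' \<Longrightarrow>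
      2 \<le> pair_dist (u n) (v n) w \<or> 2 \<le> pair_dist (u n') (v n') w"
    and far: "\<And>n w w'. w \<in> M \<Longrightarrow> w' \<in> M \<Longrightarrow>
      2 \<le> pair_dist (u n) (v n) w \<Longrightarrow> 2 \<le> pair_dist (u n) (v n) w' \<Longrightarrow>
      dist w w' \<le> pair_dist (u n) (v n) w + pair_dist (u n) (v n) w' - 1"
  shows "SSD2P (Lip0 M z) (lip_norm M)"
  unfolding SSD2P_def
proof (intro allI impI)
  fix k :: nat and S :: "nat \<Rightarrow> ('a \<Rightarrow> real) set" and \<epsilon> :: real
  assume "0 < \<epsilon>" and "\<forall>i\<in>{1..k}. S i \<in> slices_on (Lip0 M z) (lip_norm M)"
  then have "\<forall>i\<in>{1..k}. \<exists>f \<alpha>. f \<in> dual_sphere_on (Lip0 M z) (lip_norm M) \<and> \<alpha> > 0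
      \<and> S i = slice_on (Lip0 M z) (lip_norm M) f \<alpha>"
    unfolding slices_on_def by blast
  then obtain f \<alpha> where f: "\<And>i. i \<in> {1..k} \<Longrightarrow> f i \<in> dual_sphere_on (Lip0 M z) (lip_norm M)"
    and \<alpha>: "\<And>i. i \<in> {1..k} \<Longrightarrow> 0 < \<alpha> i"
    and S: "\<And>i. i \<in> {1..k} \<Longrightarrow> S i = slice_on (Lip0 M z) (lip_norm M) (f i) (\<alpha> i)"
    by metis
  have f_dual: "f i \<in> dual_on (Lip0 M z) (lip_norm M)" if "i \<in> {1..k}" for i
    using f[OF that] by (simp add: dual_sphere_on_def)
  have f_add: "f i (p + q) = f i p + f i q" if "i \<in> {1..k}" "p \<in> Lip0 M z" "q \<in> Lip0 M z" for i p q
    using f_dual that by (simp add: dual_on_def)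
  have "\<forall>i\<in>{1..k}. \<exists>x. x \<in> slice_on (Lip0 M z) (lip_norm M) (f i) (\<alpha> i)"
    using slice_on_nonempty[OF normed_space_Lip0[OF z]] f \<alpha> by metis
  then obtain x where x: "\<And>i. i \<in> {1..k} \<Longrightarrow> x i \<in> slice_on (Lip0 M z) (lip_norm M) (f i) (\<alpha> i)"
    by metis
  then have x_Lip: "x i \<in> Lip0 M z" "lip_norm M (x i) \<le> 1" "1 - \<alpha> i < f i (x i)" if "i \<in> {1..k}" for i
    using that by (auto simp: slice_on_def unit_ball_on_def)
  define D where "D n = pair_dist (u n) (v n)" for n
  \<comment> \<open>The functions must keep the value \<open>0\<close> at the origin; at most one pair is too close to it.\<close>
  define J where "J = {n. 2 \<le> D n z}"
  have "J \<supseteq> UNIV - {n. \<not> 2 \<le> D n z}" by (auto simp: J_def)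
  moreover have "finite {n. \<not> 2 \<le> D n z}"
  proof (cases "\<exists>a. \<not> 2 \<le> D a z")
    case True
    then obtain a where "\<not> 2 \<le> D a z" by blast
    then have "{n. \<not> 2 \<le> D n z} \<subseteq> {a}" using disjoint[OF z] by (auto simp: D_def)
    then show ?thesis using finite_subset by blast
  qed simp
  ultimately have J: "infinite J"
    by (metis Diff_infinite_finite infinite_UNIV_nat infinite_super)
  define \<phi> where "\<phi> n = dipole (u n) (v n)" for n
  have z_off: "z \<noteq> u n" "z \<noteq> v n" if "n \<in> J" for n
    using that by (auto simp: J_def D_def pair_dist_def)
  have \<phi>: "\<phi> n \<in> Lip0 M z" "lip_norm M (\<phi> n) = 1" if "n \<in> J" for n
    using dipole_lip_norm[OF discrete uv z_off[OF that]] by (simp_all add: \<phi>_def)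
  have \<phi>_far: "\<phi> n w = 0" if "2 \<le> D n w" for n w
    using that by (auto simp: D_def pair_dist_def \<phi>_def dipole_def)
  have \<phi>_bound: "\<bar>\<phi> n w\<bar> \<le> 1" for n w by (simp add: \<phi>_def dipole_def)
  define flat where "flat i n y \<longleftrightarrow> y \<in> Lip0 M z \<and> lip_norm M (y + \<phi> n) \<le> 1 \<and> lip_norm M (y - \<phi> n) \<le> 1
      \<and> (\<forall>w. 2 \<le> D n w \<longrightarrow> y w = x i w) \<and> (\<forall>w. \<bar>y w - x i w\<bar> \<le> 2 * R)" for i n y
  have "\<exists>y. flat i n y" if "i \<in> {1..k}" "n \<in> J" for i n
  proof (rule flatten_at_pair[OF discrete diam uv z _ far x_Lip(1,2)[OF that(1)]])
    show "2 \<le> pair_dist (u n) (v n) z" using that by (simp add: J_def D_def)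
  qed (use that in \<open>auto simp: flat_def \<phi>_def D_def\<close>)
  then obtain y where "\<And>i n. i \<in> {1..k} \<Longrightarrow> n \<in> J \<Longrightarrow> flat i n (y i n)"
    by metis
  then have y: "y i n \<in> Lip0 M z"
    and y_norm: "lip_norm M (y i n + \<phi> n) \<le> 1" "lip_norm M (y i n - \<phi> n) \<le> 1"
    and y_far: "\<And>w. 2 \<le> D n w \<Longrightarrow> y i n w = x i w"
    and y_close: "\<And>w. \<bar>y i n w - x i w\<bar> \<le> 2 * R"
    if "i \<in> {1..k}" "n \<in> J" for i n
    using that by (auto simp: flat_def)
  \<comment> \<open>The total change of \<open>x i\<close>; the values \<open>0\<close>, \<open>1\<close>, \<open>-1\<close> of \<open>t\<close> give the three
    members that each slice must contain.\<close>
  define h where "h t i n = (y i n + t *\<^sub>R \<phi> n) - x i" for t :: real and i n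
  have h: "h t i n \<in> Lip0 M z" if "i \<in> {1..k}" "n \<in> J" for t i n
    unfolding h_def using y[OF that] \<phi>[OF that(2)] x_Lip(1)[OF that(1)]
    by (intro subspace_diff[OF subspace_Lip0] subspace_add[OF subspace_Lip0] subspace_scale[OF subspace_Lip0])
  have h_bound: "\<bar>h t i n w\<bar> \<le> 2 * R + 1" if "i \<in> {1..k}" "n \<in> J" "\<bar>t\<bar> \<le> 1" for t i n w
  proof -
    have "\<bar>t * \<phi> n w\<bar> \<le> 1"
      using mult_mono[OF that(3) \<phi>_bound[of n w]] by (simp add: abs_mult)
    then show ?thesis using y_close[OF that(1,2), of w] by (simp add: h_def)
  qed
  have h_far: "h t i n w = 0" if "i \<in> {1..k}" "n \<in> J" "2 \<le> D n w" for t i n w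
    using y_far[OF that] \<phi>_far[OF that(3)] by (simp add: h_def)
  have h_disjoint: "h t i n w = 0 \<or> h t i n' w = 0"
    if "i \<in> {1..k}" "n \<in> J" "n' \<in> J" "n \<noteq> n'" for t i n n' w
  proof (cases "w \<in> M")
    case True
    then show ?thesis using disjoint[OF True that(4)] h_far that unfolding D_def by blast
  next
    case False
    then show ?thesis using h[OF that(1,2)] by (simp add: Lip0_def)
  qed
  define \<delta> where "\<delta> i = f i (x i) - (1 - \<alpha> i)" for i
  define Bad where "Bad t i = {n \<in> J. \<delta> i \<le> \<bar>f i (h t i n)\<bar>}" for t i
  have "finite (Bad t i)" if i: "i \<in> {1..k}" and t: "\<bar>t\<bar> \<le> 1" for t i
  proof -
    have "0 < \<delta> i" using x_Lip(3)[OF i] by (simp add: \<delta>_def)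
    from disjoint_supports_weakly_null[where M = M and J = J and h = "h t i" and C = "2 * R + 1",
        OF discrete f_dual[OF i] h[OF i] h_bound[OF i _ t] h_disjoint[OF i] this]
    show ?thesis unfolding Bad_def by simp
  qed
  then have "finite (\<Union>t\<in>{-1,0,1}. \<Union>i\<in>{1..k}. Bad t i)"
    by (intro finite_UN_I) auto
  from infinite_imp_nonempty[OF Diff_infinite_finite[OF this J]]
  obtain n where "n \<in> J - (\<Union>t\<in>{-1,0,1}. \<Union>i\<in>{1..k}. Bad t i)"
    by (meson ex_in_conv)
  then have n: "n \<in> J" "\<And>t i. t \<in> {-1,0,1} \<Longrightarrow> i \<in> {1..k} \<Longrightarrow> n \<notin> Bad t i"
    by blast+
  have large: "1 - \<alpha> i < f i (y i n + t *\<^sub>R \<phi> n)" if "i \<in> {1..k}" "t \<in> {-1,0,1}" for t i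
  proof -
    have "y i n + t *\<^sub>R \<phi> n = x i + h t i n" by (simp add: h_def)
    then have "f i (y i n + t *\<^sub>R \<phi> n) = f i (x i) + f i (h t i n)"
      using f_add[OF that(1) x_Lip(1)[OF that(1)] h[OF that(1) n(1)]] by simp
    moreover have "\<bar>f i (h t i n)\<bar> < \<delta> i" using n(2)[OF that(2,1)] n(1) by (simp add: Bad_def)
    ultimately show ?thesis by (simp add: \<delta>_def)
  qed
  have plus: "y i n + \<phi> n \<in> S i" if "i \<in> {1..k}" for i
    using large[OF that, of 1] y_norm(1)[OF that n(1)] y[OF that n(1)] \<phi>(1)[OF n(1)] subspace_Lip0
    by (auto simp: S[OF that] slice_on_def unit_ball_on_def intro: subspace_add)
  have minus: "y i n - \<phi> n \<in> S i" if "i \<in> {1..k}" for i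
    using large[OF that, of "-1"] y_norm(2)[OF that n(1)] y[OF that n(1)] \<phi>(1)[OF n(1)] subspace_Lip0
    by (auto simp: S[OF that] slice_on_def unit_ball_on_def intro: subspace_diff)
  have mid: "y i n \<in> S i" if "i \<in> {1..k}" for i
  proof -
    have "lip_norm M (y i n) \<le> 1"
    proof (rule lip_norm_leI)
      fix a b assume ab: "a \<in> M" "b \<in> M"
      have bnd: "\<bar>g a - g b\<bar> \<le> dist a b" if "g \<in> Lip0 M z" "lip_norm M g \<le> 1" for g
        using lip_norm_bound[OF that(1) ab] mult_right_mono[OF that(2) zero_le_dist[of a b]] by simp
      have "y i n + \<phi> n \<in> Lip0 M z" "y i n - \<phi> n \<in> Lip0 M z"
        using y[OF that n(1)] \<phi>(1)[OF n(1)] subspace_Lip0 by (auto intro: subspace_add subspace_diff)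
      from bnd[OF this(1) y_norm(1)[OF that n(1)]] bnd[OF this(2) y_norm(2)[OF that n(1)]]
      show "\<bar>y i n a - y i n b\<bar> \<le> 1 * dist a b" by simp
    qed simp
    then show ?thesis
      using large[OF that, of 0] y[OF that n(1)] by (simp add: S[OF that] slice_on_def unit_ball_on_def)
  qed
  have "\<phi> n \<in> unit_ball_on (Lip0 M z) (lip_norm M)" "lip_norm M (\<phi> n) > 1 - \<epsilon>"
    using \<phi>[OF n(1)] \<open>0 < \<epsilon>\<close> by (simp_all add: unit_ball_on_def)
  with plus minus mid show "\<exists>x \<phi>. (\<forall>i\<in>{1..k}. x i \<in> S i) \<and> \<phi> \<in> unit_ball_on (Lip0 M z) (lip_norm M)
      \<and> lip_norm M \<phi> > 1 - \<epsilon> \<and> (\<forall>i\<in>{1..k}. x i + \<phi> \<in> S i \<and> x i - \<phi> \<in> S i)"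
    by (intro exI[of _ "\<lambda>i. y i n"] exI[of _ "\<phi> n"]) blast
qed

section \<open>The spaces of integer-valued sequences\<close>

lemma K_apply:
  assumes "x \<in> K m"
  obtains a where "apply_bcontfun x k = real a" "a \<le> m"
  using assms unfolding K_def by (metis (no_types, lifting) atLeastAtMost_iff imageE mem_Collect_eq)

lemma dist_apply_le_dist: "\<bar>apply_bcontfun x k - apply_bcontfun y k\<bar> \<le> dist x y" for x y :: ell_infty
  using dist_bounded[of x k y] by (simp add: dist_real_def)

lemma dist_K_le:
  assumes "x \<in> K m" "y \<in> K m"
  shows "dist x y \<le> real m"
proof (rule dist_bound)
  fix k
  show "dist (apply_bcontfun x k) (apply_bcontfun y k) \<le> real m"
    by (rule K_apply[OF assms(1), of k], rule K_apply[OF assms(2), of k]) (simp add: dist_real_def)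
qed

lemma dist_K_ge:
  assumes "x \<in> K m" "y \<in> K m" "x \<noteq> y"
  shows "1 \<le> dist x y"
proof -
  obtain k where k: "apply_bcontfun x k \<noteq> apply_bcontfun y k"
    using assms(3) bcontfun_eqI by blast
  obtain a b where "apply_bcontfun x k = real a" "apply_bcontfun y k = real b"
    using K_apply assms(1,2) by metis
  with k have "1 \<le> \<bar>apply_bcontfun x k - apply_bcontfun y k\<bar>" by auto
  then show ?thesis using dist_apply_le_dist[of x k y] by linarith
qed

text \<open>
  The points \<open>u\<^sub>n\<close> and \<open>v\<^sub>n\<close> are \<open>spike m 0 n\<close> and \<open>spike m 1 n\<close>.  Place \<open>0\<close> is reserved for
  telling them apart, so that the spikes start at place \<open>1\<close>.
\<close>
definition spike :: "nat \<Rightarrow> nat \<Rightarrow> nat \<Rightarrow> ell_infty" where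
  "spike m j n = Bcontfun (\<lambda>k. if k = 0 then real j else if k = Suc n then real m else 0)"

lemma spike_apply:
  "apply_bcontfun (spike m j n) k = (if k = 0 then real j else if k = Suc n then real m else 0)"
proof -
  have "(\<lambda>k. if k = 0 then real j else if k = Suc n then real m else 0) \<in> bcontfun"
    by (rule bcontfun_normI[of _ "real (max j m)"]) auto
  then show ?thesis by (simp add: spike_def Bcontfun_inverse)
qed

lemma spike_in_K: "j \<le> m \<Longrightarrow> spike m j n \<in> K m"
  by (auto simp: K_def spike_apply)

lemma dist_spike_spike: "dist (spike m 0 n) (spike m 1 n) = 1"
proof (rule antisym)
  show "dist (spike m 0 n) (spike m 1 n) \<le> 1"
    by (rule dist_bound) (simp add: spike_apply)
  show "1 \<le> dist (spike m 0 n) (spike m 1 n)"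
    using dist_apply_le_dist[of "spike m 0 n" 0 "spike m 1 n"] by (simp add: spike_apply)
qed

lemma spikes_far_apart:
  assumes "3 \<le> m" "w \<in> K m" "n \<noteq> n'"
  shows "2 \<le> dist (spike m j n) w \<or> 2 \<le> dist (spike m j' n') w"
proof -
  obtain a where "apply_bcontfun w (Suc n) = real a"
    using K_apply[OF assms(2)] by blast
  then have "\<bar>real m - real a\<bar> \<le> dist (spike m j n) w" "real a \<le> dist (spike m j' n') w"
    using dist_apply_le_dist[of "spike m j n" "Suc n" w]
      dist_apply_le_dist[of "spike m j' n'" "Suc n" w] assms(3)
    by (auto simp: spike_apply)
  moreover have "2 \<le> \<bar>real m - real a\<bar> \<or> 2 \<le> real a"
    using assms(1) by (cases "a \<le> 1") auto
  ultimately show ?thesis by linarith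
qed

text \<open>
  Let \<open>p\<close> and \<open>p'\<close> be the two spikes and \<open>k\<close> a place.  If \<open>k\<close> is not \<open>0\<close>, then \<open>p\<close> and \<open>p'\<close> agree
  at \<open>k\<close>, with the extreme value \<open>0\<close> or \<open>m\<close>; whichever of \<open>w\<close> and \<open>w'\<close> is farther from it at
  \<open>k\<close> is at least \<open>\<bar>w k - w' k\<bar>\<close> away from its spike, and the other one at least \<open>2\<close>.  At
  place \<open>0\<close> the spikes may have the value \<open>1\<close>, which costs at most \<open>1\<close>; the same \<open>2\<close> pays for it.
\<close>
lemma dist_via_spikes:
  assumes "w \<in> K m" "w' \<in> K m" "j \<le> 1" "j' \<le> 1"
    and far: "2 \<le> dist (spike m j n) w" "2 \<le> dist (spike m j' n) w'"
  shows "dist w w' \<le> dist (spike m j n) w + dist (spike m j' n) w' - 1"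
proof (rule dist_bound)
  fix k
  obtain a a' where a: "apply_bcontfun w k = real a" "a \<le> m" "apply_bcontfun w' k = real a'" "a' \<le> m"
    using K_apply assms(1,2) by metis
  let ?p = "if k = 0 then real j else if k = Suc n then real m else 0"
  let ?p' = "if k = 0 then real j' else if k = Suc n then real m else 0"
  have "\<bar>?p - real a\<bar> \<le> dist (spike m j n) w" "\<bar>?p' - real a'\<bar> \<le> dist (spike m j' n) w'"
    using dist_apply_le_dist[of "spike m j n" k w] dist_apply_le_dist[of "spike m j' n" k w'] a
    by (auto simp: spike_apply)
  then have "\<bar>real a - real a'\<bar> \<le> dist (spike m j n) w + dist (spike m j' n) w' - 1"
    using far a assms(3,4) by (auto split: if_splits)
  then show "dist (apply_bcontfun w k) (apply_bcontfun w' k)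
      \<le> dist (spike m j n) w + dist (spike m j' n) w' - 1"
    using a by (simp add: dist_real_def)
qed

theorem proposition2p7:
  fixes m :: nat and z :: ell_infty
  assumes "m \<ge> 3" and "z \<in> K m"
  shows "SSD2P (Lip0 (K m) z) (lip_norm (K m))"
proof (rule SSD2P_criterion[where u = "spike m 0" and v = "spike m 1" and R = "real m"])
  show "2 \<le> pair_dist (spike m 0 n) (spike m 1 n) w \<or> 2 \<le> pair_dist (spike m 0 n') (spike m 1 n') w"
    if "w \<in> K m" "n \<noteq> n'" for n n' w
    using spikes_far_apart[OF assms(1) that] unfolding pair_dist_def min_def by presburger
  show "dist w w' \<le> pair_dist (spike m 0 n) (spike m 1 n) w + pair_dist (spike m 0 n) (spike m 1 n) w' - 1"
    if "w \<in> K m" "w' \<in> K m" "2 \<le> pair_dist (spike m 0 n) (spike m 1 n) w"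
      "2 \<le> pair_dist (spike m 0 n) (spike m 1 n) w'" for n w w'
    using that dist_via_spikes[OF that(1,2), of 0 0 n] dist_via_spikes[OF that(1,2), of 0 1 n]
      dist_via_spikes[OF that(1,2), of 1 0 n] dist_via_spikes[OF that(1,2), of 1 1 n]
    unfolding pair_dist_def by (auto simp: min_def split: if_splits)
qed (use assms in \<open>auto simp: dist_K_le dist_K_ge spike_in_K dist_spike_spike[simplified]\<close>)

end
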